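(* Let $p$ and $q$ be positive integers with $p<q$, and let $\varepsilon>0$. Then for all sufficiently large $N$ there is a collection of $q$ graphs $G_0,\ldots,G_{q-1}$ on a common vertex set $V$ with $|V|=N$ such that every pair of distinct vertices of $V$ is an edge of exactly $p$ of these graphs, and for each $f\in\{0,1,\ldots,q-1\}$: (i) $G_f$ has edge density $e(G_f)/\binom{N}{2}\in[p/q-\varepsilon,\,p/q+\varepsilon]$; (ii) $G_f$ has no vertex subset $U$ with $|U|\ge\varepsilon N$ such that among any $q$ vertices of $U$ there are $p+1$ vertices with at least $\varepsilon N$ common neighbors in $G_f$. *)

theory Defs
  imports Complex_Main
begin

text \<open>A simple graph on a finite vertex set \<open>V\<close> is given by its set of edges, each edge
  being a two-element subset of \<open>V\<close>.\<close>

definition simple_graph :: "'a set \<Rightarrow> 'a set set \<Rightarrow> bool" where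
  "simple_graph V E \<longleftrightarrow> finite V \<and> (\<forall>e\<in>E. e \<subseteq> V \<and> card e = 2)"

definition edge_density :: "'a set \<Rightarrow> 'a set set \<Rightarrow> real" where
  "edge_density V E = real (card E) / real (card V choose 2)"

definition common_neighbors :: "'a set \<Rightarrow> 'a set set \<Rightarrow> 'a set \<Rightarrow> 'a set" where
  "common_neighbors V E W = {v \<in> V. \<forall>w\<in>W. {w, v} \<in> E}"

end

theory Submission
  imports Defs
begin

text \<open>
  Label the vertices evenly by words over \<open>\<int>/qL\<close> of length \<open>n = KL\<close>, let \<open>\<chi>(u, v) \<in> \<int>/q\<close> be a
  colour of the sum of the labels of \<open>u\<close> and \<open>v\<close>, and let \<open>uv\<close> be an edge of \<open>G\<^sub>f\<close> if
  \<open>(f + \<chi>(u, v)) mod q < p\<close>. Every pair then lies in exactly \<open>p\<close> graphs. The colour is chosen so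
  that adding \<open>L\<close> to all letters of a word adds \<open>1\<close> to its colour, which makes \<open>\<chi>(u, \<cdot>)\<close> equidistributed
  and gives the edge density \<open>p/q\<close>.

  By concentration of measure, a dense vertex set has labels within Hamming distance \<open>O(\<surd>n)\<close> of all
  \<open>q\<close> rotations of some word. Changing so few letters rarely changes the colour, so the
  corresponding \<open>q\<close> vertices have pairwise distinct colours \<open>\<chi>(\<cdot>, v)\<close> for almost every \<open>v\<close>. Only
  \<open>p\<close> colours give an edge of \<open>G\<^sub>f\<close>, hence almost no \<open>v\<close> is a common neighbour of \<open>p + 1\<close> of them.
\<close>

section \<open>Words over a finite alphabet\<close>

definition words :: "nat \<Rightarrow> nat \<Rightarrow> nat list set" where
  "words M n = {xs. set xs \<subseteq> {..<M} \<and> length xs = n}"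

lemma finite_words [simp]: "finite (words M n)"
  unfolding words_def by (rule finite_lists_length_eq) simp

lemma card_words: "card (words M n) = M ^ n"
  unfolding words_def by (subst card_lists_length_eq) auto

lemma words_0 [simp]: "words M 0 = {[]}"
  by (auto simp: words_def)

lemma Cons_in_words_Suc [simp]: "a # xs \<in> words M (Suc n) \<longleftrightarrow> a < M \<and> xs \<in> words M n"
  by (auto simp: words_def)

lemma words_Suc: "words M (Suc n) = (\<lambda>(a, xs). a # xs) ` ({..<M} \<times> words M n)"
  unfolding words_def by (subst lists_length_Suc_eq) (force simp: image_iff)

lemma sum_words_Suc:
  "(\<Sum>x\<in>words M (Suc n). f x) = (\<Sum>xs\<in>words M n. \<Sum>a<M. f (a # xs))"
proof -
  have "(\<Sum>x\<in>words M (Suc n). f x) = (\<Sum>(a, xs)\<in>{..<M} \<times> words M n. f (a # xs))"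
    unfolding words_Suc by (subst sum.reindex) (auto simp: inj_on_def case_prod_unfold)
  also have "\<dots> = (\<Sum>a<M. \<Sum>xs\<in>words M n. f (a # xs))"
    by (rule sum.cartesian_product [symmetric])
  also have "\<dots> = (\<Sum>xs\<in>words M n. \<Sum>a<M. f (a # xs))"
    by (rule sum.swap)
  finally show ?thesis .
qed

section \<open>Hamming distance and concentration of measure\<close>

fun hamming :: "'a list \<Rightarrow> 'a list \<Rightarrow> nat" where
  "hamming (x # xs) (y # ys) = of_bool (x \<noteq> y) + hamming xs ys"
| "hamming _ _ = 0"

lemma hamming_refl [simp]: "hamming xs xs = 0"
  by (induction xs) auto

lemma hamming_commute: "hamming xs ys = hamming ys xs"
  by (induction xs ys rule: hamming.induct) auto

lemma hamming_triangle:
  "length xs = length ys \<Longrightarrow> length ys = length zs \<Longrightarrow>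
    hamming xs zs \<le> hamming xs ys + hamming ys zs"
  by (induction xs ys zs rule: list_induct3) auto

text \<open>Efron--Stein for the uniform distribution on words, by conditioning on all letters but
  the first.\<close>

lemma variance_lipschitz_words:
  fixes f :: "nat list \<Rightarrow> real"
  assumes "0 < M"
    and "\<And>x y. x \<in> words M n \<Longrightarrow> y \<in> words M n \<Longrightarrow> \<bar>f x - f y\<bar> \<le> real (hamming x y)"
  shows "real (M ^ n) * (\<Sum>x\<in>words M n. (f x)\<^sup>2) \<le> (\<Sum>x\<in>words M n. f x)\<^sup>2 + real n * (real (M ^ n))\<^sup>2"
  using assms(2)
proof (induction n arbitrary: f)
  case 0
  then show ?case by simp
next
  case (Suc n)
  define F where "F xs = (\<Sum>a<M. f (a # xs))" for xs
  have M: "real M > 0" using assms(1) by simp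
  \<comment> \<open>The square sum times \<open>M\<close>, minus \<open>(F xs)\<^sup>2\<close>, is
    half the sum of squared differences over all pairs of first letters. Each difference is at most
    1 in absolute value, and the resulting bound \<open>M\<^sup>2 / 2\<close> is relaxed to
    \<open>M\<^sup>2\<close>.\<close>
  have one: "real M * (\<Sum>a<M. (f (a # xs))\<^sup>2) \<le> (F xs)\<^sup>2 + (real M)\<^sup>2" if "xs \<in> words M n" for xs
  proof -
    have "2 * (real M * (\<Sum>a<M. (f (a # xs))\<^sup>2) - (F xs)\<^sup>2)
        = (\<Sum>a<M. \<Sum>b<M. (f (a # xs) - f (b # xs))\<^sup>2)"
      by (simp add: F_def power2_diff sum.distrib sum_subtractf power2_eq_square sum_product
          sum_distrib_left algebra_simps)
    also have "\<dots> \<le> (\<Sum>a<M. \<Sum>b<M. 1)"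
    proof (intro sum_mono)
      fix a b assume "a \<in> {..<M}" "b \<in> {..<M}"
      then have "\<bar>f (a # xs) - f (b # xs)\<bar> \<le> 1"
        using Suc.prems [of "a # xs" "b # xs"] that by (cases "a = b") auto
      then show "(f (a # xs) - f (b # xs))\<^sup>2 \<le> 1"
        by (simp add: abs_square_le_1)
    qed
    also have "\<dots> = (real M)\<^sup>2" by (simp add: power2_eq_square)
    finally have *: "2 * (real M * (\<Sum>a<M. (f (a # xs))\<^sup>2) - (F xs)\<^sup>2) \<le> (real M)\<^sup>2" .
    have "u \<le> v + w" if "2 * (u - v) \<le> w" "0 \<le> w" for u v w :: real
      using that by argo
    from this [OF * zero_le_power2] show ?thesis .
  qed
  \<comment> \<open>Averaging over the first letter preserves the Lipschitz condition, so the
    induction hypothesis applies to the averaged function.\<close>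
  have "\<bar>F x / M - F y / M\<bar> \<le> real (hamming x y)" if "x \<in> words M n" "y \<in> words M n" for x y
  proof -
    have "\<bar>F x - F y\<bar> \<le> (\<Sum>a<M. \<bar>f (a # x) - f (a # y)\<bar>)"
      unfolding F_def sum_subtractf [symmetric] by (rule sum_abs)
    also have "\<dots> \<le> (\<Sum>a<M. real (hamming x y))"
    proof (intro sum_mono)
      fix a assume "a \<in> {..<M}"
      then show "\<bar>f (a # x) - f (a # y)\<bar> \<le> real (hamming x y)"
        using Suc.prems [of "a # x" "a # y"] that by simp
    qed
    finally show ?thesis
      using M by (simp add: diff_divide_distrib [symmetric] field_simps)
  qed
  then have "real (M ^ n) * (\<Sum>x\<in>words M n. (F x / M)\<^sup>2)
      \<le> (\<Sum>x\<in>words M n. F x / M)\<^sup>2 + real n * (real (M ^ n))\<^sup>2"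
    by (rule Suc.IH)
  then have IH: "real (M ^ n) * (\<Sum>x\<in>words M n. (F x)\<^sup>2)
      \<le> (\<Sum>x\<in>words M n. F x)\<^sup>2 + real n * (real (M ^ Suc n))\<^sup>2"
    using M by (simp add: sum_divide_distrib [symmetric] power_divide field_simps)
  \<comment> \<open>Total variance: the first letter contributes \<open>(M ^ Suc n)\<^sup>2\<close>
    through \<open>one\<close>, the other \<open>n\<close> letters contribute the bound
    \<open>IH\<close>.\<close>
  have "real (M ^ Suc n) * (\<Sum>x\<in>words M (Suc n). (f x)\<^sup>2)
      = real (M ^ n) * (\<Sum>xs\<in>words M n. real M * (\<Sum>a<M. (f (a # xs))\<^sup>2))"
    by (simp add: sum_words_Suc sum_distrib_left [symmetric])
  also have "\<dots> \<le> real (M ^ n) * (\<Sum>xs\<in>words M n. (F xs)\<^sup>2 + (real M)\<^sup>2)"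
    by (intro mult_left_mono sum_mono one) auto
  also have "\<dots> = real (M ^ n) * (\<Sum>xs\<in>words M n. (F xs)\<^sup>2) + (real (M ^ Suc n))\<^sup>2"
    by (simp add: sum.distrib card_words power2_eq_square algebra_simps)
  also have "\<dots> \<le> (\<Sum>x\<in>words M n. F x)\<^sup>2 + real n * (real (M ^ Suc n))\<^sup>2 + (real (M ^ Suc n))\<^sup>2"
    using IH by simp
  also have "(\<Sum>x\<in>words M n. F x) = (\<Sum>x\<in>words M (Suc n). f x)"
    by (simp add: sum_words_Suc F_def)
  finally show ?case by (simp add: algebra_simps)
qed

text \<open>The function \<open>x \<mapsto> hamming x (g x)\<close> is the distance to \<open>A\<close>; it vanishes on \<open>A\<close>, so its
  variance is at least \<open>card A / M ^ n\<close> times the square of its mean.\<close>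

lemma mean_distance_le:
  assumes "0 < M" and "A \<subseteq> words M n" and "0 < \<mu>" and "\<mu> * real (M ^ n) \<le> real (card A)"
  obtains g where "\<And>x. x \<in> words M n \<Longrightarrow> g x \<in> A"
    and "(\<Sum>x\<in>words M n. real (hamming x (g x))) \<le> sqrt (n / \<mu>) * real (M ^ n)"
proof -
  have finA: "finite A" using assms(2) finite_words by (rule finite_subset)
  have "A \<noteq> {}"
  proof
    assume "A = {}"
    then have "\<mu> * real (M ^ n) \<le> 0" using assms(4) by simp
    moreover have "0 < real M ^ n" using assms(1) by simp
    ultimately show False using assms(3) by (simp add: mult_le_0_iff)
  qed
  define g where "g x = arg_min_on (hamming x) A" for x
  have gA: "g x \<in> A" for x
    unfolding g_def using finA \<open>A \<noteq> {}\<close> by (rule arg_min_if_finite)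
  have g_le: "hamming x (g x) \<le> hamming x a" if "a \<in> A" for x a
    unfolding g_def using finA \<open>A \<noteq> {}\<close> that by (rule arg_min_least)
  define f where "f x = real (hamming x (g x))" for x
  \<comment> \<open>A nearest point for \<open>y\<close> is a candidate for \<open>x\<close>, so the
    distance to \<open>A\<close> is 1-Lipschitz.\<close>
  have f_le: "f x \<le> f y + real (hamming x y)" if "x \<in> words M n" "y \<in> words M n" for x y
  proof -
    have "hamming x (g x) \<le> hamming x (g y)" by (rule g_le) (rule gA)
    also have "\<dots> \<le> hamming x y + hamming y (g y)"
      using that gA [of y] assms(2) by (intro hamming_triangle) (auto simp: words_def)
    finally show ?thesis by (simp add: f_def)
  qed
  have f0: "f x = 0" if "x \<in> A" for x
    using g_le [OF that, of x] by (simp add: f_def)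
  have "\<bar>f x - f y\<bar> \<le> real (hamming x y)" if "x \<in> words M n" "y \<in> words M n" for x y
    using f_le [OF that] f_le [OF that(2,1)] by (simp add: hamming_commute)
  from variance_lipschitz_words [OF assms(1) this]
  have var: "real (M ^ n) * (\<Sum>x\<in>words M n. (f x)\<^sup>2) \<le> (\<Sum>x\<in>words M n. f x)\<^sup>2 + real n * (real (M ^ n))\<^sup>2" .
  define T where "T = real (M ^ n)"
  define m where "m = (\<Sum>x\<in>words M n. f x) / T"
  have T: "T > 0" using assms(1) by (simp add: T_def)
  have S: "(\<Sum>x\<in>words M n. f x) = m * T" using T by (simp add: m_def)
  have "\<mu> * T * m\<^sup>2 \<le> real (card A) * m\<^sup>2"
    using assms(4) by (intro mult_right_mono) (auto simp: T_def)
  also have "\<dots> = (\<Sum>x\<in>A. (f x - m)\<^sup>2)" by (simp add: f0)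
  also have "\<dots> \<le> (\<Sum>x\<in>words M n. (f x - m)\<^sup>2)"
    using assms(2) by (intro sum_mono2) auto
  also have "\<dots> = (\<Sum>x\<in>words M n. (f x)\<^sup>2) - 2 * m * (\<Sum>x\<in>words M n. f x) + T * m\<^sup>2"
    by (simp add: power2_diff sum.distrib sum_subtractf sum_distrib_left card_words T_def algebra_simps)
  also have "\<dots> = (\<Sum>x\<in>words M n. (f x)\<^sup>2) - T * m\<^sup>2"
    unfolding S by (simp add: power2_eq_square algebra_simps)
  also have "\<dots> \<le> real n * T"
  proof -
    have "T * (\<Sum>x\<in>words M n. (f x)\<^sup>2) \<le> T * (real n * T + T * m\<^sup>2)"
      using var unfolding S T_def [symmetric] by (simp add: power2_eq_square algebra_simps)
    then show ?thesis using T by simp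
  qed
  finally have "m\<^sup>2 \<le> n / \<mu>" using T assms(3) by (simp add: field_simps)
  then have "m \<le> sqrt (n / \<mu>)" by (rule real_le_rsqrt)
  then have "(\<Sum>x\<in>words M n. f x) \<le> sqrt (n / \<mu>) * T"
    unfolding S using T by simp
  then show ?thesis
    using that [of g] gA unfolding f_def T_def by blast
qed

section \<open>Letter shifts and the colour of a word\<close>

lemma mod_add_right_cancel_nat:
  fixes a b s M :: nat
  assumes "(a + s) mod M = (b + s) mod M"
  shows "a mod M = b mod M"
proof -
  have "(int a + int s) mod int M = (int b + int s) mod int M"
    using assms by (metis of_nat_add zmod_int)
  from mod_diff_cong [OF this refl [of "int s mod int M"]]
  have "int a mod int M = int b mod int M" by simp
  then show ?thesis by (simp add: zmod_int [symmetric])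
qed

definition shift :: "nat \<Rightarrow> nat \<Rightarrow> nat list \<Rightarrow> nat list" where
  "shift M s = map (\<lambda>a. (a + s) mod M)"

lemma bij_betw_shift: "bij_betw (shift M s) (words M n) (words M n)"
proof (cases "M = 0")
  case True
  have "shift M s x = x" if "x \<in> words M n" for x
    using that True by (auto simp: shift_def words_def)
  then show ?thesis
    using bij_betw_cong [of "words M n" "shift M s" id] by simp
next
  case False
  have inj: "inj_on (shift M s) (words M n)"
  proof (rule inj_onI)
    fix x y assume xy: "x \<in> words M n" "y \<in> words M n" "shift M s x = shift M s y"
    have "inj_on (\<lambda>a. (a + s) mod M) {..<M}"
    proof (rule inj_onI)
      fix a b assume "a \<in> {..<M}" "b \<in> {..<M}" "(a + s) mod M = (b + s) mod M"
      then show "a = b"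
        using mod_add_right_cancel_nat [of a s M b] by simp
    qed
    then have "inj_on (\<lambda>a. (a + s) mod M) (set x \<union> set y)"
      by (rule inj_on_subset) (use xy in \<open>auto simp: words_def\<close>)
    with xy(3) show "x = y"
      unfolding shift_def by (rule map_inj_on)
  qed
  have "shift M s ` words M n \<subseteq> words M n"
    using False by (auto simp: shift_def words_def)
  with inj show ?thesis
    by (simp add: bij_betw_def endo_inj_surj)
qed

text \<open>What \<open>first_hit\<close> reads from a letter depends only on the residue modulo
  \<open>q * L\<close>, so shifted letters may wrap around without affecting the colour.\<close>

lemma mod_cancel_mult:
  fixes a b q L :: nat
  assumes "a mod (q * L) = b mod (q * L)"
  shows "L dvd a \<longleftrightarrow> L dvd b" and "a div L mod q = b div L mod q"
proof -
  have "a mod L = b mod L"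
    by (metis assms mod_mod_cancel dvd_triv_right)
  then show "L dvd a \<longleftrightarrow> L dvd b" by (simp add: dvd_eq_mod_eq_0)
  have *: "c div L mod q = c mod (q * L) div L" for c
    using mod_mult2_eq [of c L q] by (cases "L = 0") (auto simp: mult.commute [of q L])
  show "a div L mod q = b div L mod q"
    unfolding * assms ..
qed

text \<open>A word is coloured by its first letter divisible by \<open>L\<close>, or by its last letter if there is
  none. Such a colour rotates when all letters are shifted by \<open>L\<close>, although changing a few letters
  rarely changes it when \<open>L\<close> is large.\<close>

fun first_hit :: "nat \<Rightarrow> nat \<Rightarrow> nat list \<Rightarrow> nat" where
  "first_hit q L [] = 0"
| "first_hit q L (a # as) = (if as = [] \<or> L dvd a then a div L mod q else first_hit q L as)"

text \<open>Adding letterwise makes the colour symmetric, as an undirected graph requires. The sums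
  stay unreduced, since \<open>first_hit\<close> sees only residues modulo
  \<open>q * L\<close>.\<close>

definition word_colour :: "nat \<Rightarrow> nat \<Rightarrow> nat list \<Rightarrow> nat list \<Rightarrow> nat" where
  "word_colour q L x y = first_hit q L (map2 (+) x y)"

lemma word_colour_commute: "word_colour q L x y = word_colour q L y x"
proof -
  have "map2 (+) x y = map2 (+) y x"
    by (induction x y rule: list_induct2') (auto simp: add.commute)
  then show ?thesis by (simp add: word_colour_def)
qed

lemma first_hit_less: "0 < q \<Longrightarrow> first_hit q L z < q"
  by (induction z) auto

text \<open>Adding \<open>j * L\<close> preserves divisibility by \<open>L\<close>, so the deciding
  letter keeps its position while its quotient by \<open>L\<close> grows by \<open>j\<close>. The
  empty word has the constant colour 0, which does not rotate.\<close>

lemma first_hit_shift: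
  assumes "0 < L" and "list_all2 (\<lambda>a b. b mod (q * L) = (a + j * L) mod (q * L)) z z'" and "z \<noteq> []"
  shows "first_hit q L z' = (first_hit q L z + j) mod q"
  using assms(2,3)
proof (induction rule: list_all2_induct)
  case Nil
  then show ?case by simp
next
  case (Cons a as b bs)
  have "L dvd b \<longleftrightarrow> L dvd a"
    using mod_cancel_mult(1) [OF Cons(1)] by simp
  moreover have "b div L mod q = (a div L mod q + j) mod q"
    using mod_cancel_mult(2) [OF Cons(1)] assms(1) by (simp add: mod_simps add.commute)
  moreover have "as = [] \<longleftrightarrow> bs = []"
    using Cons(2) by auto
  ultimately show ?case using Cons.IH by auto
qed

lemma word_colour_shift:
  assumes "0 < L" and "length x = length y" and "x \<noteq> []"
  shows "word_colour q L (shift (q * L) (j * L) x) y = (word_colour q L x y + j) mod q"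
  unfolding word_colour_def
proof (rule first_hit_shift [OF assms(1)])
  have "(((a + j * L) mod (q * L)) + b) mod (q * L) = (a + b + j * L) mod (q * L)" for a b :: nat
    using mod_add_left_eq [of "a + j * L" "q * L" b] by (simp only: add_ac)
  then show "list_all2 (\<lambda>a b. b mod (q * L) = (a + j * L) mod (q * L)) (map2 (+) x y)
      (map2 (+) (shift (q * L) (j * L) x) y)"
    using assms(2) by (auto simp: list_all2_conv_all_nth shift_def)
  show "map2 (+) x y \<noteq> []" using assms(2,3) by (cases x; cases y) auto
qed

section \<open>Stability of the colour under changes of few letters\<close>

text \<open>Each block of \<open>L\<close> consecutive letters contains exactly one hit; the
  induction adds one block at a time.\<close>

lemma card_dvd_add:
  fixes x q L :: nat
  assumes "0 < L"
  shows "card {a. a < q * L \<and> L dvd x + a} = q"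
proof (induction q)
  case 0
  then show ?case by simp
next
  case (Suc q)
  \<comment> \<open>The offset is the residue of \<open>- (x + q * L)\<close> modulo
    \<open>L\<close>; the outer \<open>mod\<close> covers the case where \<open>q * L\<close> itself
    is a hit.\<close>
  define b where "b = q * L + (L - (x + q * L) mod L) mod L"
  have r: "b \<ge> q * L" "b < Suc q * L" using assms by (auto simp: b_def)
  have "(x + b) mod L = (x + (L - x mod L)) mod L"
    by (simp add: b_def) (metis add.left_commute mod_add_right_eq mod_mult_self3)
  also have "\<dots> = (x mod L + (L - x mod L)) mod L"
    by (simp add: mod_simps)
  also have "\<dots> = 0" using assms by simp
  finally have d: "L dvd x + b" by auto
  have u: "c = b" if "q * L \<le> c" "c < Suc q * L" "L dvd x + c" for c
  proof -
    have "\<bar>int c - int b\<bar> < int L" using that r by (auto simp: algebra_simps)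
    moreover have "int L dvd int (x + c) - int (x + b)"
      using that(3) d by (intro dvd_diff) (simp_all only: int_dvd_int_iff)
    then have "int L dvd int c - int b" by simp
    ultimately show "c = b"
      using dvd_imp_le_int [of "int c - int b" "int L"] by fastforce
  qed
  have "{a. a < Suc q * L \<and> L dvd x + a} = insert b {a. a < q * L \<and> L dvd x + a}"
  proof (rule set_eqI)
    fix c
    show "c \<in> {a. a < Suc q * L \<and> L dvd x + a} \<longleftrightarrow> c \<in> insert b {a. a < q * L \<and> L dvd x + a}"
      using r d u [of c] by (cases "c < q * L") auto
  qed
  then show ?case using Suc.IH r by simp
qed

text \<open>The disjunct \<open>n = 0\<close> makes the induction work: the default colour of words without a hit
  is counted as a change.\<close>

lemma card_word_colour_neq_le:
  fixes q L n :: nat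
  defines "M \<equiv> q * L"
  assumes "0 < q" and "0 < L" and "x \<in> words M n" and "x' \<in> words M n"
  shows "real (card {y \<in> words M n. n = 0 \<or> word_colour q L x y \<noteq> word_colour q L x' y})
    \<le> (2 * hamming x x' / L + (1 - 1 / L) ^ n) * M ^ n"
  using assms(4,5)
proof (induction n arbitrary: x x')
  case 0
  then show ?case by simp
next
  case (Suc n)
  obtain a xs where x: "x = a # xs" "a < M" "xs \<in> words M n"
    using Suc.prems(1) by (cases x) (auto simp: words_def)
  obtain b xs' where x': "x' = b # xs'" "b < M" "xs' \<in> words M n"
    using Suc.prems(2) by (cases x') (auto simp: words_def)
  define D where "D = {y \<in> words M n. n = 0 \<or> word_colour q L xs y \<noteq> word_colour q L xs' y}"
  define D' where "D' = {y \<in> words M (Suc n). word_colour q L x y \<noteq> word_colour q L x' y}"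
  define H where "H c = {y. y < M \<and> L dvd c + y}" for c
  define h where "h = real (hamming xs xs')"
  define r where "r = (1 - 1 / real L) ^ n"
  define T where "T = real (M ^ n)"
  have H: "finite (H c)" "card (H c) = q" "H c \<subseteq> {..<M}" for c
    using card_dvd_add [OF assms(3)] by (auto simp: H_def M_def)
  have finD: "finite D" by (simp add: D_def)
  have IH: "real (card D) \<le> (2 * h / L + r) * T"
    using Suc.IH [OF x(3) x'(3)] by (simp add: D_def h_def r_def T_def)
  \<comment> \<open>If \<open>a \<noteq> b\<close>, a hit by \<open>y\<close> against
    \<open>a\<close> or \<open>b\<close> may change the colour whatever the tail is. Without a hit
    the tails decide, so \<open>ys\<close> lies in \<open>D\<close>; for \<open>n = 0\<close> the
    default colours may differ, but then \<open>D\<close> is everything. If \<open>a = b\<close>, a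
    hit gives both words the same colour.\<close>
  have "D' \<subseteq> (\<lambda>(y, ys). y # ys) ` ((if a = b then {} else H a \<union> H b) \<times> words M n \<union> ({..<M} - H a) \<times> D)"
  proof
    fix w assume w: "w \<in> D'"
    then obtain y ys where y: "w = y # ys" "y < M" "ys \<in> words M n"
      unfolding D'_def by (cases w) (auto simp: words_def)
    have len: "length xs = n" "length xs' = n" "length ys = n"
      using x(3) x'(3) y(3) by (auto simp: words_def)
    have "(a \<noteq> b \<and> (y \<in> H a \<or> y \<in> H b)) \<or> (y \<notin> H a \<and> ys \<in> D)"
      using w y len unfolding D'_def D_def x x' H_def word_colour_def
      by (auto split: if_splits)
    then show "w \<in> (\<lambda>(y, ys). y # ys) ` ((if a = b then {} else H a \<union> H b) \<times> words M n \<union> ({..<M} - H a) \<times> D)"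
      using y by (intro image_eqI [of _ _ "(y, ys)"]) auto
  qed
  then have "card D' \<le> card ((\<lambda>(y, ys). y # ys) ` ((if a = b then {} else H a \<union> H b) \<times> words M n \<union> ({..<M} - H a) \<times> D))"
    using H finD by (intro card_mono finite_imageI finite_UnI finite_cartesian_product) auto
  also have "\<dots> \<le> card ((if a = b then {} else H a \<union> H b) \<times> words M n \<union> ({..<M} - H a) \<times> D)"
    using H finD by (intro card_image_le finite_UnI finite_cartesian_product) auto
  also have "\<dots> \<le> card ((if a = b then {} else H a \<union> H b) \<times> words M n) + card (({..<M} - H a) \<times> D)"
    by (rule card_Un_le)
  also have "\<dots> \<le> of_bool (a \<noteq> b) * (2 * q) * M ^ n + (M - q) * card D"
    using card_Un_le [of "H a" "H b"] H
    by (auto simp: card_cartesian_product card_words card_Diff_subset intro!: mult_right_mono)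
  finally have "real (card D') \<le> real (of_bool (a \<noteq> b) * (2 * q) * M ^ n + (M - q) * card D)"
    by (simp only: of_nat_le_iff)
  also have "\<dots> = of_bool (a \<noteq> b) * (2 * q) * T + (1 - 1 / L) * M * card D"
    using assms(3) by (simp add: T_def M_def of_nat_diff field_simps)
  also have "\<dots> \<le> of_bool (a \<noteq> b) * (2 * q) * T + (1 - 1 / L) * M * ((2 * h / L + r) * T)"
    using assms(3) by (intro add_left_mono mult_left_mono IH) auto
  also have "\<dots> = (of_bool (a \<noteq> b) * 2 / L + (1 - 1 / L) * (2 * h / L) + (1 - 1 / L) * r) * (M * T)"
    using assms(3) by (simp add: M_def field_simps)
  \<comment> \<open>The factor \<open>1 - 1 / L\<close> is dropped from the Hamming term and kept on
    \<open>r\<close>, where it builds up the power.\<close>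
  also have "\<dots> \<le> (of_bool (a \<noteq> b) * 2 / L + 2 * h / L + (1 - 1 / L) * r) * (M * T)"
  proof -
    have "(1 - 1 / L) * (2 * h / L) \<le> 2 * h / L"
      using mult_right_mono [of "1 - 1 / real L" 1 "2 * h / L"] by (simp add: h_def)
    then show ?thesis
      by (intro mult_right_mono [OF add_right_mono [OF add_left_mono]]) (auto simp: T_def)
  qed
  also have "\<dots> = (2 * hamming x x' / L + (1 - 1 / L) ^ Suc n) * M ^ Suc n"
    by (simp add: x x' h_def r_def T_def add_divide_distrib)
  finally show ?case by (simp add: D'_def)
qed

section \<open>Equidistribution of colours and rainbow tuples\<close>

text \<open>Shifting by \<open>j * L\<close> permutes the words and rotates the colours by
  \<open>j\<close>, so all \<open>q\<close> colour classes have the same size.\<close>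

lemma card_word_colour_eq:
  assumes "0 < q" and "0 < L" and "0 < n" and "x \<in> words (q * L) n" and "k < q"
  shows "q * card {y \<in> words (q * L) n. word_colour q L x y = k} = (q * L) ^ n"
proof -
  define C where "C i = {y \<in> words (q * L) n. word_colour q L x y = i}" for i
  have fin: "finite (C i)" for i by (simp add: C_def)
  have le: "card (C i) \<le> card (C ((i + j) mod q))" for i j
  proof (rule card_inj_on_le)
    show "inj_on (shift (q * L) (j * L)) (C i)"
      using bij_betw_shift [of "q * L" "j * L" n] by (auto simp: C_def bij_betw_def inj_on_def)
    show "shift (q * L) (j * L) ` C i \<subseteq> C ((i + j) mod q)"
    proof clarify
      fix y assume "y \<in> C i"
      then have y: "y \<in> words (q * L) n" "word_colour q L x y = i" by (auto simp: C_def)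
      then have "shift (q * L) (j * L) y \<in> words (q * L) n"
        using bij_betw_shift [of "q * L" "j * L" n] by (auto simp: bij_betw_def)
      moreover have "word_colour q L x (shift (q * L) (j * L) y) = (i + j) mod q"
      proof -
        have "word_colour q L (shift (q * L) (j * L) y) x = (word_colour q L y x + j) mod q"
          using y(1) assms(2,3,4) by (intro word_colour_shift) (auto simp: words_def)
        then show ?thesis using y(2) by (metis word_colour_commute)
      qed
      ultimately show "shift (q * L) (j * L) y \<in> C ((i + j) mod q)" by (simp add: C_def)
    qed
  qed (rule fin)
  \<comment> \<open>Rotation by \<open>q - i\<close> maps class \<open>i\<close> into class 0 and
    rotation by \<open>i\<close> maps class 0 into class \<open>i\<close>, so the one-sided bounds
    \<open>le\<close> give equality.\<close>
  have eq: "card (C i) = card (C 0)" if "i < q" for i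
  proof (rule antisym)
    show "card (C i) \<le> card (C 0)" using le [of i "q - i"] that by simp
    show "card (C 0) \<le> card (C i)" using le [of 0 i] that by simp
  qed
  have "words (q * L) n = (\<Union>i<q. C i)"
    using first_hit_less [OF assms(1)] by (auto simp: C_def word_colour_def)
  then have "(q * L) ^ n = card (\<Union>i<q. C i)" by (metis card_words)
  also have "\<dots> = (\<Sum>i<q. card (C i))"
    using fin by (intro card_UN_disjoint) (auto simp: C_def)
  also have "\<dots> = (\<Sum>i<q. card (C k))"
  proof (rule sum.cong [OF refl])
    fix i assume "i \<in> {..<q}"
    then have "i < q" by simp
    then show "card (C i) = card (C k)" unfolding eq [OF assms(5)] by (rule eq)
  qed
  also have "\<dots> = q * card (C k)" by simp
  finally show ?thesis by (simp add: C_def)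
qed

text \<open>A dense set of words comes close to all \<open>q\<close> rotations of some word \<open>x\<close>, and the colours
  given by these rotations are distinct at every \<open>y\<close>.\<close>

lemma dense_words_rainbow:
  assumes "0 < q" and "0 < L" and "0 < n" and "0 < \<delta>"
    and "A \<subseteq> words (q * L) n" and "\<delta> * real ((q * L) ^ n) \<le> real (card A)"
  obtains a where "\<And>j. a j \<in> A"
    and "real (card {y \<in> words (q * L) n. \<not> inj_on (\<lambda>j. word_colour q L (a j) y) {..<q}})
      \<le> (2 * (q * sqrt (n / \<delta>)) / L + q * (1 - 1 / L) ^ n) * real ((q * L) ^ n)"
proof -
  define W where "W = words (q * L) n"
  define T where "T = real ((q * L) ^ n)"
  have qL: "0 < q * L" using assms(1,2) by simp
  have T: "T > 0" using qL by (simp add: T_def)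
  obtain g where g: "\<And>x. x \<in> W \<Longrightarrow> g x \<in> A"
    and sum_g: "(\<Sum>x\<in>W. real (hamming x (g x))) \<le> sqrt (n / \<delta>) * T"
    unfolding W_def T_def using mean_distance_le [OF qL assms(5,4,6)] by metis
  define \<sigma> where "\<sigma> j = shift (q * L) (j * L)" for j
  have \<sigma>: "bij_betw (\<sigma> j) W W" for j
    unfolding \<sigma>_def W_def by (rule bij_betw_shift)
  then have \<sigma>W: "\<sigma> j x \<in> W" if "x \<in> W" for j x
    using that by (auto simp: bij_betw_def)
  define h where "h j x = real (hamming (\<sigma> j x) (g (\<sigma> j x)))" for j x
  \<comment> \<open>Every rotation permutes \<open>W\<close>, so the mean over \<open>x\<close> of
    the total distance from the \<open>q\<close> rotations of \<open>x\<close> is at most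
    \<open>q\<close> times the mean distance; some \<open>x\<close> does no worse than the
    mean.\<close>
  have "(\<Sum>x\<in>W. \<Sum>j<q. h j x) = (\<Sum>j<q. \<Sum>x\<in>W. h j x)"
    by (rule sum.swap)
  also have "\<dots> = (\<Sum>j<q. \<Sum>x\<in>W. real (hamming x (g x)))"
    unfolding h_def using \<sigma> by (intro sum.cong refl sum.reindex_bij_betw)
  also have "\<dots> \<le> q * (sqrt (n / \<delta>) * T)"
    using sum_g by (simp add: mult_left_mono)
  finally have total: "(\<Sum>x\<in>W. \<Sum>j<q. h j x) \<le> (\<Sum>x\<in>W. q * sqrt (n / \<delta>))"
    by (simp add: W_def card_words T_def mult.commute mult.left_commute)
  have "W \<noteq> {}"
    using card_words [of "q * L" n] qL unfolding W_def by fastforce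
  obtain x where x: "x \<in> W" "(\<Sum>j<q. h j x) \<le> q * sqrt (n / \<delta>)"
  proof -
    have "\<exists>x\<in>W. (\<Sum>j<q. h j x) \<le> q * sqrt (n / \<delta>)"
    proof (rule ccontr)
      assume "\<not> ?thesis"
      then have "(\<Sum>x\<in>W. q * sqrt (n / \<delta>)) < (\<Sum>x\<in>W. \<Sum>j<q. h j x)"
        using \<open>W \<noteq> {}\<close> by (intro sum_strict_mono) (auto simp: W_def not_le)
      with total show False by simp
    qed
    then show ?thesis using that by blast
  qed
  define a where "a j = g (\<sigma> j x)" for j
  have aA: "a j \<in> A" for j using g \<sigma>W x(1) by (simp add: a_def)
  define B where "B j = {y \<in> W. word_colour q L (\<sigma> j x) y \<noteq> word_colour q L (a j) y}" for j
  have B: "real (card (B j)) \<le> (2 * h j x / L + (1 - 1 / L) ^ n) * T" for j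
    using card_word_colour_neq_le [OF assms(1,2), of "\<sigma> j x" n "a j"] \<sigma>W [OF x(1), of j] aA [of j] assms(3,5)
    by (auto simp: B_def W_def h_def a_def T_def)
  \<comment> \<open>Outside all \<open>B j\<close>, the colour of \<open>a j\<close> at
    \<open>y\<close> equals that of the \<open>j\<close>-th rotation of \<open>x\<close>, namely
    \<open>j\<close> plus a constant modulo \<open>q\<close>; these are distinct for
    \<open>j < q\<close>.\<close>
  have sub: "{y \<in> W. \<not> inj_on (\<lambda>j. word_colour q L (a j) y) {..<q}} \<subseteq> (\<Union>j<q. B j)"
  proof clarify
    fix y assume y: "y \<in> W" and ni: "\<not> inj_on (\<lambda>j. word_colour q L (a j) y) {..<q}"
    show "y \<in> (\<Union>j<q. B j)"
    proof (rule ccontr)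
      assume nb: "y \<notin> (\<Union>j<q. B j)"
      have "word_colour q L (a j) y = (j + word_colour q L x y) mod q" if "j < q" for j
      proof -
        have "word_colour q L (a j) y = word_colour q L (\<sigma> j x) y"
          using nb y that by (auto simp: B_def)
        also have "\<dots> = (word_colour q L x y + j) mod q"
          unfolding \<sigma>_def using x(1) y assms(2,3)
          by (intro word_colour_shift) (auto simp: W_def words_def)
        finally show ?thesis by (simp add: add.commute)
      qed
      then have "inj_on (\<lambda>j. word_colour q L (a j) y) {..<q}"
        by (intro inj_onI) (metis lessThan_iff mod_add_right_cancel_nat mod_less)
      with ni show False by contradiction
    qed
  qed
  have "card {y \<in> W. \<not> inj_on (\<lambda>j. word_colour q L (a j) y) {..<q}} \<le> card (\<Union>j<q. B j)"
    by (rule card_mono [OF _ sub]) (auto simp: B_def W_def)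
  also have "\<dots> \<le> (\<Sum>j<q. card (B j))"
    by (rule card_UN_le) simp
  finally have "real (card {y \<in> W. \<not> inj_on (\<lambda>j. word_colour q L (a j) y) {..<q}})
      \<le> (\<Sum>j<q. real (card (B j)))"
    by (simp only: of_nat_sum [symmetric] of_nat_le_iff)
  also have "\<dots> \<le> (\<Sum>j<q. (2 * h j x / L + (1 - 1 / L) ^ n) * T)"
    by (intro sum_mono B)
  also have "\<dots> = (2 * (\<Sum>j<q. h j x) / L + q * (1 - 1 / L) ^ n) * T"
    by (simp add: sum.distrib sum_distrib_left sum_distrib_right sum_divide_distrib distrib_right)
  also have "\<dots> \<le> (2 * (q * sqrt (n / \<delta>)) / L + q * (1 - 1 / L) ^ n) * T"
    using x(2) T by (intro mult_right_mono add_right_mono divide_right_mono mult_left_mono) auto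
  finally show ?thesis
    using that [OF aA] by (simp only: W_def T_def)
qed

section \<open>Parameters, and transfer of the colouring to natural numbers\<close>

text \<open>The second term is at most \<open>c * exp (- K)\<close> for every \<open>L\<close>, so
  \<open>K\<close> is fixed first. The first term is then of order \<open>1 / sqrt L\<close>, and a
  large \<open>L\<close> makes it small.\<close>

lemma parameters_exist:
  fixes \<delta> c :: real
  assumes "0 < \<delta>" and "0 < c"
  obtains K L :: nat where "0 < K" and "0 < L"
    and "2 * (c * sqrt (real (K * L) / \<delta>)) / L + c * (1 - 1 / L) ^ (K * L) < \<delta>"
proof -
  obtain k :: nat where k: "ln (2 * c / \<delta>) < k" using reals_Archimedean2 by blast
  define K where "K = Suc k"
  have "2 * c / \<delta> = exp (ln (2 * c / \<delta>))" using assms by simp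
  also have "\<dots> < exp (real K)" using k by (simp add: K_def)
  finally have K: "c * exp (- real K) < \<delta> / 2"
    using assms by (simp add: exp_minus field_simps)
  obtain s :: nat where s: "4 * c * sqrt (K / \<delta>) / \<delta> < s" using reals_Archimedean2 by blast
  have "0 < 4 * c * sqrt (K / \<delta>) / \<delta>" using assms by (simp add: K_def)
  with s have s0: "0 < real s" by linarith
  \<comment> \<open>A perfect square makes \<open>sqrt L\<close> equal to the natural number
    \<open>s\<close>.\<close>
  define L where "L = s\<^sup>2"
  have L0: "0 < L" using s0 by (simp add: L_def)
  have "sqrt (real (K * L) / \<delta>) = sqrt (K / \<delta>) * s"
    by (simp add: L_def real_sqrt_mult real_sqrt_divide)
  then have "2 * (c * sqrt (real (K * L) / \<delta>)) / L = 2 * c * sqrt (K / \<delta>) / s"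
    using s0 by (simp add: L_def power2_eq_square)
  moreover have "2 * c * sqrt (K / \<delta>) / s < \<delta> / 2" using s s0 assms by (simp add: field_simps)
  ultimately have L: "2 * (c * sqrt (real (K * L) / \<delta>)) / L < \<delta> / 2" by simp
  moreover have "c * (1 - 1 / L) ^ (K * L) \<le> c * exp (- real K)"
  proof -
    have "(1 - 1 / L) ^ (K * L) \<le> exp (- 1 / L) ^ (K * L)"
      using exp_ge_add_one_self [of "- 1 / real L"] L0 by (intro power_mono) auto
    also have "\<dots> = exp (- real K)"
      using L0 by (simp add: exp_of_nat_mult [symmetric])
    finally show ?thesis using assms by simp
  qed
  ultimately have "2 * (c * sqrt (real (K * L) / \<delta>)) / L + c * (1 - 1 / L) ^ (K * L) < \<delta>"
    using K L by linarith
  then show ?thesis using that [of K L] L0 by (simp add: K_def)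
qed

text \<open>Enumerating the words turns \<open>word_colour\<close> into a colouring of pairs of
  labels below \<open>m\<close>. The graph construction relies only on the properties listed
  here.\<close>

lemma rainbow_colouring_exists:
  fixes q :: nat and \<delta> :: real
  assumes "0 < q" and "0 < \<delta>"
  obtains m :: nat and \<chi> :: "nat \<Rightarrow> nat \<Rightarrow> nat" where "0 < m"
    and "\<And>u v. \<chi> u v = \<chi> v u"
    and "\<And>u v. \<chi> u v < q"
    and "\<And>u k. u < m \<Longrightarrow> k < q \<Longrightarrow> q * card {v. v < m \<and> \<chi> u v = k} = m"
    and "\<And>A. A \<subseteq> {..<m} \<Longrightarrow> \<delta> * m \<le> card A \<Longrightarrow>
      \<exists>a. (\<forall>j. a j \<in> A) \<and> card {v. v < m \<and> \<not> inj_on (\<lambda>j. \<chi> (a j) v) {..<q}} < \<delta> * m"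
proof -
  obtain K L :: nat where KL: "0 < K" "0 < L"
    "2 * (q * sqrt (real (K * L) / \<delta>)) / L + q * (1 - 1 / L) ^ (K * L) < \<delta>"
    using parameters_exist [of \<delta> "real q"] assms by auto
  define n where "n = K * L"
  define W where "W = words (q * L) n"
  define m where "m = card W"
  have m: "m = (q * L) ^ n" by (simp add: m_def W_def card_words)
  have m0: "0 < m" using assms KL by (simp add: m)
  have n0: "0 < n" using KL by (simp add: n_def)
  obtain w where w: "bij_betw w {..<m} W"
    using ex_bij_betw_nat_finite [of W] by (auto simp: W_def m_def atLeast0LessThan)
  define \<chi> where "\<chi> u v = word_colour q L (w u) (w v)" for u v
  have card_w: "card {v. v < m \<and> P (w v)} = card {y \<in> W. P y}" for P
  proof -
    have "bij_betw w {v. v < m \<and> P (w v)} {y \<in> W. P y}"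
      using w by (auto simp: bij_betw_def inj_on_def)
    then show ?thesis by (rule bij_betw_same_card)
  qed
  show ?thesis
  proof (rule that [of m \<chi>])
    show "0 < m" by (rule m0)
    show "\<chi> u v = \<chi> v u" for u v
      unfolding \<chi>_def by (rule word_colour_commute)
    show "\<chi> u v < q" for u v
      unfolding \<chi>_def word_colour_def by (rule first_hit_less) (rule assms(1))
  next
    fix u k assume "u < m" "k < q"
    moreover from this have "w u \<in> words (q * L) n"
      using w by (auto simp: bij_betw_def W_def)
    ultimately show "q * card {v. v < m \<and> \<chi> u v = k} = m"
      using card_word_colour_eq [OF assms(1) KL(2) n0, of "w u" k]
        card_w [of "\<lambda>y. word_colour q L (w u) y = k"]
      by (simp add: \<chi>_def W_def m)
  next
    fix A assume A: "A \<subseteq> {..<m}" "\<delta> * m \<le> card A"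
    have "w ` A \<subseteq> W" using A w by (auto simp: bij_betw_def)
    moreover have "card (w ` A) = card A"
      using A w by (intro card_image) (auto simp: bij_betw_def inj_on_def)
    ultimately have wA: "w ` A \<subseteq> words (q * L) n" "\<delta> * real ((q * L) ^ n) \<le> real (card (w ` A))"
      using A(2) by (simp_all only: W_def m)
    obtain b where b: "\<And>j. b j \<in> w ` A"
      and card_b: "real (card {y \<in> W. \<not> inj_on (\<lambda>j. word_colour q L (b j) y) {..<q}})
        \<le> (2 * (q * sqrt (n / \<delta>)) / L + q * (1 - 1 / L) ^ n) * m"
      unfolding m W_def
      by (rule dense_words_rainbow [OF assms(1) KL(2) n0 assms(2) wA]) blast
    have "\<forall>j. \<exists>u. u \<in> A \<and> b j = w u" using b by blast
    then have "\<exists>a. \<forall>j. a j \<in> A \<and> b j = w (a j)" by (rule choice)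
    then obtain a where a: "\<And>j. a j \<in> A" "\<And>j. b j = w (a j)" by blast
    have "real (card {v. v < m \<and> \<not> inj_on (\<lambda>j. \<chi> (a j) v) {..<q}})
        \<le> (2 * (q * sqrt (n / \<delta>)) / L + q * (1 - 1 / L) ^ n) * m"
      using card_b card_w [of "\<lambda>y. \<not> inj_on (\<lambda>j. word_colour q L (w (a j)) y) {..<q}"]
      by (simp add: \<chi>_def a(2))
    also have "\<dots> < \<delta> * m"
      using KL(3) m0 unfolding n_def by (intro mult_strict_right_mono) auto
    finally show "\<exists>a. (\<forall>j. a j \<in> A) \<and> card {v. v < m \<and> \<not> inj_on (\<lambda>j. \<chi> (a j) v) {..<q}} < \<delta> * m"
      using a(1) by blast
  qed
qed

section \<open>Counting residues\<close>

text \<open>Below \<open>v\<close> there are \<open>v div m\<close> full periods with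
  \<open>card Y\<close> hits each, and one partial period with at most \<open>card Y\<close>
  hits.\<close>

lemma card_residues:
  fixes m v :: nat
  assumes "0 < m" and "Y \<subseteq> {..<m}"
  shows "\<bar>real (card {u. u < v \<and> u mod m \<in> Y}) - card Y * (v / m)\<bar> \<le> card Y"
proof -
  define S where "S = {u. u < v \<and> u mod m \<in> Y}"
  define k where "k = v div m"
  have finY: "finite Y" using assms(2) finite_subset by blast
  have inj: "inj_on (\<lambda>(y, i). y + i * m) (Y \<times> I)" for I
  proof (rule inj_onI, clarify)
    fix y i y' i' assume y: "y \<in> Y" "y' \<in> Y" and eq: "y + i * m = y' + i' * m"
    then have "y < m" "y' < m" using assms(2) by auto
    moreover have "(y + i * m) mod m = (y' + i' * m) mod m" using eq by simp
    ultimately have "y = y'" by simp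
    with eq assms(1) show "y = y' \<and> i = i'" by simp
  qed
  have "(\<lambda>(y, i). y + i * m) ` (Y \<times> {..<k}) \<subseteq> S"
  proof clarify
    fix y i assume yi: "y \<in> Y" "i < k"
    then have y: "y < m" using assms(2) by auto
    have "y + i * m < Suc i * m" using y by simp
    also have "\<dots> \<le> k * m" using yi(2) by (intro mult_right_mono) auto
    also have "\<dots> \<le> v" by (simp add: k_def)
    finally show "y + i * m \<in> S" using y yi by (simp add: S_def)
  qed
  then have "card ((\<lambda>(y, i). y + i * m) ` (Y \<times> {..<k})) \<le> card S"
    by (intro card_mono) (auto simp: S_def)
  then have lower: "card Y * k \<le> card S"
    by (simp add: card_image [OF inj] card_cartesian_product)
  have "S \<subseteq> (\<lambda>(y, i). y + i * m) ` (Y \<times> {..k})"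
  proof
    fix u assume "u \<in> S"
    then have "u mod m \<in> Y" "u div m \<le> k"
      by (auto simp: S_def k_def intro: div_le_mono)
    then show "u \<in> (\<lambda>(y, i). y + i * m) ` (Y \<times> {..k})"
      by (intro image_eqI [of _ _ "(u mod m, u div m)"]) auto
  qed
  then have "card S \<le> card ((\<lambda>(y, i). y + i * m) ` (Y \<times> {..k}))"
    using finY by (intro card_mono) auto
  then have upper: "card S \<le> card Y * Suc k"
    by (simp only: card_image [OF inj] card_cartesian_product card_atMost)
  have "real v = real (k * m + v mod m)" unfolding k_def by simp
  then have "real v = real k * m + real (v mod m)" by (simp only: of_nat_add of_nat_mult)
  moreover have "real (v mod m) \<le> m" using assms(1) by simp
  ultimately have k: "real k \<le> v / m" "v / m \<le> real k + 1"
    using assms(1) by (simp_all add: field_simps)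
  have "real (card Y) * k \<le> card Y * (v / m)"
    by (rule mult_left_mono [OF k(1)]) simp
  moreover have "card Y * (v / m) \<le> card Y * (real k + 1)"
    by (rule mult_left_mono [OF k(2)]) simp
  moreover have "real (card Y) * k \<le> card S" "real (card S) \<le> card Y * (real k + 1)"
    using lower upper by (simp_all only: of_nat_mult [symmetric] of_nat_Suc [symmetric] of_nat_le_iff add.commute)
  ultimately show ?thesis
    unfolding S_def [symmetric] by (simp add: abs_le_iff algebra_simps)
qed

text \<open>For \<open>m \<le> N\<close> the rounding error is at most the main term
  \<open>card Y * (N / m)\<close>. The resulting factor 2 is why the rainbow property is applied
  with \<open>\<epsilon> / 2\<close>.\<close>

lemma card_residues_le:
  fixes m N :: nat
  assumes "0 < m" and "m \<le> N" and "Y \<subseteq> {..<m}"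
  shows "real (card {u. u < N \<and> u mod m \<in> Y}) * m \<le> 2 * card Y * N"
proof -
  have "real (card {u. u < N \<and> u mod m \<in> Y}) \<le> card Y * (N / m) + real (card Y) * 1"
    using card_residues [OF assms(1,3), of N] by simp
  also have "\<dots> \<le> card Y * (N / m) + card Y * (N / m)"
    by (intro add_left_mono mult_left_mono) (use assms(1,2) in auto)
  finally show ?thesis using assms(1) by (simp add: field_simps)
qed

text \<open>Adding \<open>c\<close> permutes the residues. This serves in two ways: for a fixed pair
  it counts the graphs containing it, and for a fixed graph it counts the colours that give an
  edge.\<close>

lemma card_rotation:
  fixes p q c :: nat
  assumes "p < q"
  shows "card {k. k < q \<and> (k + c) mod q < p} = p"
proof -
  define r where "r k = (k + c) mod q" for k
  have inj: "inj_on r {..<q}"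
  proof (rule inj_onI)
    fix i j assume "i \<in> {..<q}" "j \<in> {..<q}" "r i = r j"
    then show "i = j" using mod_add_right_cancel_nat [of i c q j] by (simp add: r_def)
  qed
  have "r ` {..<q} \<subseteq> {..<q}" using assms by (auto simp: r_def)
  then have surj: "r ` {..<q} = {..<q}" using inj by (intro endo_inj_surj) auto
  have "r ` {k. k < q \<and> r k < p} = {..<p}"
  proof
    show "{..<p} \<subseteq> r ` {k. k < q \<and> r k < p}"
    proof
      fix i assume "i \<in> {..<p}"
      then have "i \<in> r ` {..<q}" using surj assms by simp
      with \<open>i \<in> {..<p}\<close> show "i \<in> r ` {k. k < q \<and> r k < p}" by auto
    qed
  qed auto
  moreover have "card (r ` {k. k < q \<and> r k < p}) = card {k. k < q \<and> r k < p}"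
    by (intro card_image inj_on_subset [OF inj]) auto
  ultimately show ?thesis by (simp add: r_def)
qed

section \<open>Blow-up graphs: edge density and common neighbours\<close>

text \<open>Vertex \<open>v\<close> carries the label \<open>v mod m\<close>. Pairs with equal
  labels are coloured too, so that every pair of vertices lies in exactly \<open>p\<close>
  graphs.\<close>

definition blowup_graph ::
  "nat \<Rightarrow> nat \<Rightarrow> nat \<Rightarrow> (nat \<Rightarrow> nat \<Rightarrow> nat) \<Rightarrow> nat \<Rightarrow> nat \<Rightarrow> nat set set" where
  "blowup_graph p q m \<chi> N f =
    {{u, v} | u v. u < v \<and> v < N \<and> (f + \<chi> (u mod m) (v mod m)) mod q < p}"

lemma simple_blowup_graph: "simple_graph {..<N} (blowup_graph p q m \<chi> N f)"
  by (auto simp: simple_graph_def blowup_graph_def)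

lemma edge_blowup_graph_iff:
  assumes "\<And>u v. \<chi> u v = \<chi> v u"
  shows "{u, v} \<in> blowup_graph p q m \<chi> N f \<longleftrightarrow>
    u \<noteq> v \<and> u < N \<and> v < N \<and> (f + \<chi> (u mod m) (v mod m)) mod q < p"
proof -
  have "{u, v} \<in> blowup_graph p q m \<chi> N f \<longleftrightarrow>
      (u < v \<and> v < N \<and> (f + \<chi> (u mod m) (v mod m)) mod q < p) \<or>
      (v < u \<and> u < N \<and> (f + \<chi> (v mod m) (u mod m)) mod q < p)"
    unfolding blowup_graph_def by (auto simp: doubleton_eq_iff)
  then show ?thesis
    unfolding assms [of "v mod m"] by (cases u v rule: linorder_cases) auto
qed

text \<open>Edges are counted by their larger endpoint \<open>v\<close>, which has
  \<open>p / q * v\<close> smaller neighbours up to an error \<open>m\<close>. Summation gives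
  \<open>p / q\<close> times \<open>N choose 2\<close> with total error at most
  \<open>N * m\<close>.\<close>

lemma blowup_graph_density:
  fixes \<epsilon> :: real
  assumes "p < q" and "0 < m"
    and sym: "\<And>u v. \<chi> u v = \<chi> v u"
    and less: "\<And>u v. \<chi> u v < q"
    and unif: "\<And>u k. u < m \<Longrightarrow> k < q \<Longrightarrow> q * card {v. v < m \<and> \<chi> u v = k} = m"
    and "2 \<le> N" and "2 * m \<le> \<epsilon> * (real N - 1)"
  shows "\<bar>edge_density {..<N} (blowup_graph p q m \<chi> N f) - p / q\<bar> \<le> \<epsilon>"
proof -
  define E where "E = blowup_graph p q m \<chi> N f"
  define Y where "Y v = {y. y < m \<and> (f + \<chi> (v mod m) y) mod q < p}" for v
  define S where "S v = {u. u < v \<and> u mod m \<in> Y v}" for v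
  have q0: "0 < q" using assms(1) by simp
  have "inj_on (\<lambda>(v, u). {u, v}) (SIGMA v:{..<N}. S v)"
    by (auto simp: inj_on_def S_def doubleton_eq_iff)
  moreover have "E = (\<lambda>(v, u). {u, v}) ` (SIGMA v:{..<N}. S v)"
  proof -
    have "u \<in> S v \<longleftrightarrow> u < v \<and> (f + \<chi> (u mod m) (v mod m)) mod q < p" for u v
      using assms(2) sym [of "u mod m" "v mod m"] by (auto simp: S_def Y_def)
    then have "E = {{u, v} | u v. v < N \<and> u \<in> S v}"
      unfolding E_def blowup_graph_def by auto
    then show ?thesis by (auto simp: image_iff)
  qed
  ultimately have "card E = card (SIGMA v:{..<N}. S v)"
    by (simp add: card_image)
  then have cardE: "card E = (\<Sum>v<N. card (S v))"
    by (simp add: S_def)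
  \<comment> \<open>Exactly \<open>p\<close> colours give an edge of graph \<open>f\<close>, and
    each colour is taken at a fraction \<open>1 / q\<close> of the labels.\<close>
  have cardY: "q * card (Y v) = p * m" for v
  proof -
    define K where "K = {k. k < q \<and> (k + f) mod q < p}"
    have "Y v = (\<Union>k\<in>K. {y. y < m \<and> \<chi> (v mod m) y = k})"
      using less by (auto simp: Y_def K_def add.commute)
    then have "card (Y v) = (\<Sum>k\<in>K. card {y. y < m \<and> \<chi> (v mod m) y = k})"
      by (simp only:) (rule card_UN_disjoint, auto simp: K_def)
    then have "q * card (Y v) = (\<Sum>k\<in>K. q * card {y. y < m \<and> \<chi> (v mod m) y = k})"
      by (simp add: sum_distrib_left)
    also have "\<dots> = (\<Sum>k\<in>K. m)"
      using assms(2) by (intro sum.cong refl unif) (auto simp: K_def)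
    also have "\<dots> = p * m"
      using card_rotation [OF assms(1), of f] by (simp add: K_def)
    finally show ?thesis .
  qed
  have S: "\<bar>real (card (S v)) - p / q * v\<bar> \<le> m" for v
  proof -
    have Ym: "Y v \<subseteq> {..<m}" by (auto simp: Y_def)
    have "real q * card (Y v) = real p * m"
      using cardY [of v] by (simp only: of_nat_mult [symmetric])
    then have "card (Y v) * (v / m) = p / q * v"
      using q0 assms(2) by (simp add: field_simps)
    moreover have "card (Y v) \<le> m"
      using card_mono [OF _ Ym] by simp
    ultimately show ?thesis
      using card_residues [OF assms(2) Ym, of v] by (simp add: S_def)
  qed
  define T where "T = real (N choose 2)"
  have T: "2 * T = real N * (real N - 1)"
  proof -
    have "2 * (N choose 2) = N * (N - 1)"
    proof -
      have "even (N * (N - 1))" by (cases N) auto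
      then show ?thesis unfolding choose_two by (rule dvd_mult_div_cancel)
    qed
    then have "2 * T = real (N * (N - 1))" unfolding T_def by (metis of_nat_mult of_nat_numeral)
    then show ?thesis using assms(6) by (simp add: of_nat_diff)
  qed
  have sum_T: "(\<Sum>v<N. real v) = T"
  proof -
    have "2 * (\<Sum>v<n. real v) = real n * (real n - 1)" for n
      by (induction n) (auto simp: algebra_simps)
    from this [of N] show ?thesis using T by simp
  qed
  have "p / q * T = (\<Sum>v<N. p / q * v)"
    unfolding sum_T [symmetric] by (rule sum_distrib_left)
  then have "\<bar>real (card E) - p / q * T\<bar> = \<bar>\<Sum>v<N. real (card (S v)) - p / q * v\<bar>"
    by (simp only: cardE sum_subtractf of_nat_sum)
  also have "\<dots> \<le> (\<Sum>v<N. \<bar>real (card (S v)) - p / q * v\<bar>)"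
    by (rule sum_abs)
  also have "\<dots> \<le> (\<Sum>v<N. real m)"
    by (intro sum_mono S)
  also have "\<dots> \<le> \<epsilon> * T"
  proof -
    have "real N * (2 * real m) \<le> real N * (\<epsilon> * (real N - 1))"
      by (rule mult_left_mono [OF assms(7)]) simp
    also have "\<dots> = \<epsilon> * (2 * T)" unfolding T by simp
    finally show ?thesis by simp
  qed
  finally have main: "\<bar>real (card E) - p / q * T\<bar> \<le> \<epsilon> * T" .
  have T0: "0 < T" using assms(6) by (simp add: T_def)
  have "real (card E) / T - p / q = (real (card E) - p / q * T) / T"
    using T0 by (simp add: diff_divide_distrib)
  then have "\<bar>real (card E) / T - p / q\<bar> = \<bar>real (card E) - p / q * T\<bar> / T"
    using T0 by (simp only: abs_divide abs_of_pos)
  also have "\<dots> \<le> \<epsilon>" using main T0 by (simp add: divide_le_eq)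
  finally show ?thesis
    by (simp add: edge_density_def E_def T_def)
qed

text \<open>The labels of a dense \<open>U\<close> are dense among all labels and so contain a
  rainbow tuple. Lifting the tuple to \<open>U\<close> yields \<open>Q\<close>.\<close>

lemma blowup_graph_sparse_common_neighbors:
  fixes \<epsilon> :: real
  assumes "p < q" and "0 < m" and "0 < \<epsilon>" and "m \<le> N"
    and sym: "\<And>u v. \<chi> u v = \<chi> v u"
    and less: "\<And>u v. \<chi> u v < q"
    and rainbow: "\<And>A. A \<subseteq> {..<m} \<Longrightarrow> \<epsilon> / 2 * m \<le> card A \<Longrightarrow>
      \<exists>a. (\<forall>j. a j \<in> A) \<and> card {v. v < m \<and> \<not> inj_on (\<lambda>j. \<chi> (a j) v) {..<q}} < \<epsilon> / 2 * m"
    and U: "U \<subseteq> {..<N}" "\<epsilon> * N \<le> card U"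
  obtains Q where "Q \<subseteq> U" and "card Q = q"
    and "\<And>W. W \<subseteq> Q \<Longrightarrow> card W = p + 1 \<Longrightarrow>
      card (common_neighbors {..<N} (blowup_graph p q m \<chi> N f) W) < \<epsilon> * N"
proof -
  have N0: "0 < N" using assms(2,4) by simp
  define A where "A = (\<lambda>u. u mod m) ` U"
  have Am: "A \<subseteq> {..<m}" using assms(2) by (auto simp: A_def)
  have "card U \<le> card {u. u < N \<and> u mod m \<in> A}"
    using U(1) by (intro card_mono) (auto simp: A_def)
  then have "\<epsilon> * N * m \<le> real (card {u. u < N \<and> u mod m \<in> A}) * m"
    using U(2) by (intro mult_right_mono) auto
  also have "\<dots> \<le> 2 * card A * N"
    by (rule card_residues_le) (use assms Am in auto)
  finally have "\<epsilon> / 2 * m * N \<le> real (card A) * N" by (simp add: algebra_simps)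
  then have "\<epsilon> / 2 * m \<le> card A"
    using N0 by (simp only: mult_le_cancel_right_pos of_nat_0_less_iff)
  from rainbow [OF Am this] obtain a where a: "\<And>j. a j \<in> A"
    and bad: "card {v. v < m \<and> \<not> inj_on (\<lambda>j. \<chi> (a j) v) {..<q}} < \<epsilon> / 2 * m" by blast
  define B where "B = {v. v < m \<and> \<not> inj_on (\<lambda>j. \<chi> (a j) v) {..<q}}"
  from a have "\<forall>j. \<exists>u. u \<in> U \<and> a j = u mod m" by (auto simp: A_def)
  then obtain u where u: "\<And>j. u j \<in> U" "\<And>j. a j = u j mod m" by metis
  \<comment> \<open>A set \<open>U\<close> this large forces \<open>\<epsilon> \<le> 1\<close>, so
    \<open>B\<close> omits some label \<open>y\<close>. The tuple has distinct colours at
    \<open>y\<close>, hence its vertices are distinct and \<open>Q\<close> has exactly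
    \<open>q\<close> elements.\<close>
  have "card U \<le> N" using card_mono [OF _ U(1)] by simp
  then have "\<epsilon> * N \<le> 1 * real N" using U(2) by simp
  then have "\<epsilon> \<le> 1" using N0 by (simp only: mult_le_cancel_right_pos of_nat_0_less_iff)
  then have "\<epsilon> / 2 * m \<le> 1 * real m" by (intro mult_right_mono) auto
  then have "card B < m" using bad by (simp add: B_def)
  then have "B \<noteq> {..<m}" by auto
  then obtain y where "inj_on (\<lambda>j. \<chi> (a j) y) {..<q}" by (auto simp: B_def)
  then have inj_u: "inj_on u {..<q}"
    by (auto simp: inj_on_def u(2))
  show ?thesis
  proof (rule that [of "u ` {..<q}"])
    show "u ` {..<q} \<subseteq> U" using u(1) by auto
    show "card (u ` {..<q}) = q" using inj_u by (simp add: card_image)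
  next
    fix W assume W: "W \<subseteq> u ` {..<q}" "card W = p + 1"
    then obtain J where J: "J \<subseteq> {..<q}" "W = u ` J" by (meson subset_imageE)
    have "card J = p + 1"
      using W(2) J inj_u by (metis card_image inj_on_subset)
    define K where "K = {k. k < q \<and> (k + f) mod q < p}"
    have "card K = p" unfolding K_def by (rule card_rotation) (rule assms(1))
    define C where "C = common_neighbors {..<N} (blowup_graph p q m \<chi> N f) W"
    have "C \<subseteq> {v. v < N \<and> v mod m \<in> B}"
    proof
      fix v assume "v \<in> C"
      then have v: "v < N" "\<And>j. j \<in> J \<Longrightarrow> {u j, v} \<in> blowup_graph p q m \<chi> N f"
        by (auto simp: C_def common_neighbors_def J(2))
      \<comment> \<open>Pigeonhole: at a label outside \<open>B\<close> the \<open>p + 1\<close>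
        vertices of \<open>W\<close> have distinct colours, but adjacency to \<open>v\<close> leaves
        only the \<open>p\<close> colours in \<open>K\<close>.\<close>
      have "v mod m \<in> B"
      proof (rule ccontr)
        assume "v mod m \<notin> B"
        then have "inj_on (\<lambda>j. \<chi> (a j) (v mod m)) J"
          using J(1) assms(2) by (auto simp: B_def intro: inj_on_subset)
        moreover have "(\<lambda>j. \<chi> (a j) (v mod m)) ` J \<subseteq> K"
          using v(2) less by (auto simp: edge_blowup_graph_iff [OF sym] K_def u(2) add.commute)
        ultimately have "card J \<le> card K"
          by (rule card_inj_on_le) (simp add: K_def)
        with \<open>card J = p + 1\<close> \<open>card K = p\<close> show False by simp
      qed
      with v(1) show "v \<in> {v. v < N \<and> v mod m \<in> B}" by simp
    qed
    then have "card C \<le> card {v. v < N \<and> v mod m \<in> B}"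
      by (intro card_mono) auto
    then have "real (card C) * m \<le> real (card {v. v < N \<and> v mod m \<in> B}) * m"
      by (intro mult_right_mono) auto
    also have "\<dots> \<le> 2 * card B * N"
      by (rule card_residues_le) (use assms in \<open>auto simp: B_def\<close>)
    also have "\<dots> = 2 * real (card B) * real N" by simp
    also have "\<dots> < 2 * (\<epsilon> / 2 * m) * N"
      using bad N0 by (intro mult_strict_right_mono mult_strict_left_mono) (auto simp: B_def)
    also have "\<dots> = \<epsilon> * N * m" by simp
    finally show "card C < \<epsilon> * N"
      using assms(2) by (simp only: mult_less_cancel_right_pos of_nat_0_less_iff)
  qed
qed

theorem theorem3p1:
  fixes p q :: nat and \<epsilon> :: real
  assumes "0 < p" and "p < q" and "0 < \<epsilon>"
  shows "\<forall>\<^sub>F N in sequentially.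
    \<exists>(V :: nat set) (G :: nat \<Rightarrow> nat set set).
      finite V \<and> card V = N \<and>
      (\<forall>f<q. simple_graph V (G f)) \<and>
      (\<forall>u\<in>V. \<forall>v\<in>V. u \<noteq> v \<longrightarrow> card {f. f < q \<and> {u, v} \<in> G f} = p) \<and>
      (\<forall>f<q.
        edge_density V (G f) \<in> {real p / real q - \<epsilon> .. real p / real q + \<epsilon>} \<and>
        \<not> (\<exists>U\<subseteq>V. real (card U) \<ge> \<epsilon> * real N \<and>
              (\<forall>Q\<subseteq>U. card Q = q \<longrightarrow>
                (\<exists>W\<subseteq>Q. card W = p + 1 \<and>
                   real (card (common_neighbors V (G f) W)) \<ge> \<epsilon> * real N))))"
proof -
  have q: "0 < q" and \<epsilon>2: "0 < \<epsilon> / 2" using assms by auto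
  obtain m :: nat and \<chi> :: "nat \<Rightarrow> nat \<Rightarrow> nat" where m: "0 < m"
    and sym: "\<And>u v. \<chi> u v = \<chi> v u"
    and less: "\<And>u v. \<chi> u v < q"
    and unif: "\<And>u k. u < m \<Longrightarrow> k < q \<Longrightarrow> q * card {v. v < m \<and> \<chi> u v = k} = m"
    and rainbow: "\<And>A. A \<subseteq> {..<m} \<Longrightarrow> \<epsilon> / 2 * m \<le> card A \<Longrightarrow>
      \<exists>a. (\<forall>j. a j \<in> A) \<and> card {v. v < m \<and> \<not> inj_on (\<lambda>j. \<chi> (a j) v) {..<q}} < \<epsilon> / 2 * m"
  proof (rule rainbow_colouring_exists [OF q \<epsilon>2], goal_cases)
    case (1 m \<chi>)
    show ?case by (rule 1(1) [OF 1(2-6)])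
  qed
  \<comment> \<open>The summands give \<open>2 \<le> N\<close> and \<open>m \<le> N\<close>; the 2
    also leaves room for the \<open>- 1\<close> in the density condition
    \<open>2 * m \<le> \<epsilon> * (N - 1)\<close>.\<close>
  define N0 where "N0 = 2 + m + nat \<lceil>2 * m / \<epsilon>\<rceil>"
  show ?thesis
  proof (rule eventually_sequentiallyI [of N0], intro exI conjI allI impI ballI)
    fix N assume N: "N0 \<le> N"
    then have "2 \<le> N" "m \<le> N" by (auto simp: N0_def)
    have "2 * m / \<epsilon> \<le> real N - 1"
    proof -
      have "2 * m / \<epsilon> \<le> nat \<lceil>2 * m / \<epsilon>\<rceil>" by (rule real_nat_ceiling_ge)
      moreover have "real (nat \<lceil>2 * m / \<epsilon>\<rceil>) + 1 \<le> N" using N unfolding N0_def by linarith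
      ultimately show ?thesis by linarith
    qed
    then have mN: "2 * real m \<le> \<epsilon> * (real N - 1)" using assms(3) by (simp add: divide_le_eq mult.commute)
    let ?G = "blowup_graph p q m \<chi> N"
    show "finite {..<N}" "card {..<N} = N" by simp_all
    show "simple_graph {..<N} (?G f)" for f by (rule simple_blowup_graph)
    show "card {f. f < q \<and> {u, v} \<in> ?G f} = p" if "u \<in> {..<N}" "v \<in> {..<N}" "u \<noteq> v" for u v
      using card_rotation [OF assms(2), of "\<chi> (u mod m) (v mod m)"] that
      by (simp add: edge_blowup_graph_iff [OF sym])
    show "edge_density {..<N} (?G f) \<in> {real p / real q - \<epsilon> .. real p / real q + \<epsilon>}" for f
      using blowup_graph_density [where \<chi> = \<chi>, OF assms(2) m sym less unif \<open>2 \<le> N\<close> mN, of f]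
      by (simp add: abs_le_iff)
    show "\<not> (\<exists>U\<subseteq>{..<N}. real (card U) \<ge> \<epsilon> * real N \<and>
        (\<forall>Q\<subseteq>U. card Q = q \<longrightarrow> (\<exists>W\<subseteq>Q. card W = p + 1 \<and>
          real (card (common_neighbors {..<N} (?G f) W)) \<ge> \<epsilon> * real N)))" for f
    proof (intro notI, elim exE conjE)
      fix U assume U: "U \<subseteq> {..<N}" "\<epsilon> * N \<le> card U"
        and *: "\<forall>Q\<subseteq>U. card Q = q \<longrightarrow> (\<exists>W\<subseteq>Q. card W = p + 1 \<and>
          real (card (common_neighbors {..<N} (?G f) W)) \<ge> \<epsilon> * real N)"
      obtain Q where Q: "Q \<subseteq> U" "card Q = q" "\<And>W. W \<subseteq> Q \<Longrightarrow> card W = p + 1 \<Longrightarrow>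
          card (common_neighbors {..<N} (?G f) W) < \<epsilon> * N"
      proof (rule blowup_graph_sparse_common_neighbors
            [where \<chi> = \<chi>, OF assms(2) m assms(3) \<open>m \<le> N\<close> sym less rainbow U, of f])
        fix Q assume "Q \<subseteq> U" "card Q = q" "\<And>W. W \<subseteq> Q \<Longrightarrow> card W = p + 1 \<Longrightarrow>
          card (common_neighbors {..<N} (?G f) W) < \<epsilon> * N"
        then show thesis by (rule that)
      qed
      from * Q(1,2) obtain W where "W \<subseteq> Q" "card W = p + 1"
        "\<epsilon> * N \<le> card (common_neighbors {..<N} (?G f) W)" by blast
      with Q(3) [of W] show False by simp
    qed
  qed
qed

end
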